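(* Let $\mathcal{M}^{PC}(\boldsymbol{\xi}\mid\boldsymbol{\theta})=\sum_{\boldsymbol{\alpha}_L\in\mathcal{A}_L} c_{\boldsymbol{\alpha}_L}(\boldsymbol{\theta})\Psi_{\boldsymbol{\alpha}_L}(\boldsymbol{\xi})$ be the conditional polynomial chaos model obtained from a truncated polynomial chaos expansion with coefficients $y_{\boldsymbol{\alpha}}$, where $c_{\boldsymbol{\alpha}_L}(\boldsymbol{\theta})=\sum_{\boldsymbol{\alpha}_K:(\boldsymbol{\alpha}_K,\boldsymbol{\alpha}_L)\in\mathcal{A}^{M,p}} y_{\boldsymbol{\alpha}_K,\boldsymbol{\alpha}_L}\Psi_{\boldsymbol{\alpha}_K}(\boldsymbol{\theta})$. For any fixed epistemic realization $\boldsymbol{\theta}$, there exists a unique Sobol' decomposition with respect to the aleatory input vector $\boldsymbol{\xi}$, $$\mathcal{M}^{PC}(\boldsymbol{\xi}\mid\boldsymbol{\theta})=\mathcal{M}^{PC}_{\boldsymbol{0}}(\boldsymbol{\theta})+\sum_{\emptyset\ne\mathbf{u}\subset\{1,\dots,L\}}\mathcal{M}^{PC}_{\mathbf{u}}(\boldsymbol{\xi}_{\mathbf{u}}\mid\boldsymbol{\theta}),$$ where $\mathcal{M}^{PC}_{\boldsymbol{0}}(\boldsymbol{\theta})$ is the conditional mean $\mathbb{E}[\mathcal{M}^{PC}(\boldsymbol{\xi}\mid\boldsymbol{\theta})]$ (expectation over $\boldsymbol{\xi}$ with $\boldsymbol{\theta}$ fixed), and each component is represented by the corresponding terms of the expansion: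 $$\mathcal{M}^{PC}_{\mathbf{u}}(\boldsymbol{\xi}_{\mathbf{u}}\mid\boldsymbol{\theta})=\sum_{\boldsymbol{\alpha}_L\in\mathcal{A}_{\mathbf{u},L}^{M,p}}c_{\boldsymbol{\alpha}_L}(\boldsymbol{\theta})\Psi_{\boldsymbol{\alpha}_L}(\boldsymbol{\xi}).$$ Under the orthonormality of the polynomial chaos basis $\Psi_{\boldsymbol{\alpha}_L}$, the conditional Sobol' indices are obtained analytically from the coefficient fields as: 1. (First-order sensitivity index) for $i\in\{1,\dots,L\}$, $$S_{i\mid\boldsymbol{\theta}}=\frac{\sum_{\boldsymbol{\alpha}_L\in\mathcal{A}_{\mathbf{u},L}^{M,p},\ \mathbf{u}=\{i\}}c_{\boldsymbol{\alpha}_L}^2(\boldsymbol{\theta})}{\sum_{\boldsymbol{\alpha}_L\in\mathcal{A}_L,\ \boldsymbol{\alpha}_L\ne\boldsymbol{0}}c_{\boldsymbol{\alpha}_L}^2(\boldsymbol{\theta})};$$ 2. (Interaction sensitivity index) for non-empty $\mathbf{u}\subset\{1,\dots,L\}$, $$S_{\mathbf{u}\mid\boldsymbol{\theta}}=\frac{\sum_{\boldsymbol{\alpha}_L\in\mathcal{A}_{\mathbf{u},L}^{M,p}}c_{\boldsymbol{\alpha}_L}^2(\boldsymbol{\theta})}{\sum_{\boldsymbol{\alpha}_L\in\mathcal{A}_L,\ \boldsymbol{\alpha}_L\ne\boldsymbol{0}}c_{\boldsymbol{\alpha}_L}^2(\boldsymbol{\theta})};$$ 3. (Total sensitivity index)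 for $i\in\{1,\dots,L\}$, $$S^T_{i\mid\boldsymbol{\theta}}=\frac{\sum_{\boldsymbol{\alpha}_L\in\mathcal{A}_L,\ \alpha_i\ne0}c_{\boldsymbol{\alpha}_L}^2(\boldsymbol{\theta})}{\sum_{\boldsymbol{\alpha}_L\in\mathcal{A}_L,\ \boldsymbol{\alpha}_L\ne\boldsymbol{0}}c_{\boldsymbol{\alpha}_L}^2(\boldsymbol{\theta})},$$ where $\alpha_i$ is the $i$-th entry of $\boldsymbol{\alpha}_L$.
   Context: Let $M=K+L$ and $p\in\mathbb{N}$, where $\mathbb{N}=\{0,1,2,\dots\}$. The random vector $\boldsymbol{X}=(\boldsymbol{\theta},\boldsymbol{\xi})$ has $M$ mutually independent real components and a joint probability density $f_{\boldsymbol{X}}$; $\boldsymbol{\theta}=(\theta_1,\dots,\theta_K)$ collects the epistemic variables and $\boldsymbol{\xi}=(\xi_1,\dots,\xi_L)$ the aleatory ones. The model output being expanded is assumed to have finite variance. Expectations and variances of functions of $\boldsymbol{\xi}$ for fixed $\boldsymbol{\theta}$ are with respect to the law of $\boldsymbol{\xi}$. For each component there is a family of univariate polynomials $(\phi_k)_{k\in\mathbb{N}}$ (possibly different for each component), with $\phi_k$ of degree $k$ and $\phi_0=1$, orthonormal with respect to the law of that component. For $\boldsymbol{\alpha}=(\boldsymbol{\alpha}_K,\boldsymbol{\alpha}_L)\in\mathbb{N}^K\times\mathbb{N}^L$, $\Psi_{\boldsymbol{\alpha}_K}(\boldsymbol{\theta})$ and $\Psi_{\boldsymbol{\alpha}_L}(\boldsymbol{\xi})$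 denote the products of the univariate polynomials of the indicated degrees over the components of $\boldsymbol{\theta}$ and of $\boldsymbol{\xi}$ respectively, and $\Psi_{\boldsymbol{\alpha}}(\boldsymbol{\theta},\boldsymbol{\xi})=\Psi_{\boldsymbol{\alpha}_K}(\boldsymbol{\theta})\Psi_{\boldsymbol{\alpha}_L}(\boldsymbol{\xi})$. The truncation set is $\mathcal{A}^{M,p}=\{\boldsymbol{\alpha}\in\mathbb{N}^M:|\boldsymbol{\alpha}|\le p\}$ with $|\boldsymbol{\alpha}|=\sum_i\alpha_i$; the truncated expansion is $\mathcal{M}^{PC}(\boldsymbol{\theta},\boldsymbol{\xi})=\sum_{\boldsymbol{\alpha}\in\mathcal{A}^{M,p}}y_{\boldsymbol{\alpha}}\Psi_{\boldsymbol{\alpha}}(\boldsymbol{\theta},\boldsymbol{\xi})$ with real coefficients $y_{\boldsymbol{\alpha}}=y_{\boldsymbol{\alpha}_K,\boldsymbol{\alpha}_L}$, and $\mathcal{M}^{PC}(\boldsymbol{\xi}\mid\boldsymbol{\theta})$ is this expression as a function of $\boldsymbol{\xi}$ for fixed $\boldsymbol{\theta}$. Index sets: $\mathcal{A}_L$ is the set of $\boldsymbol{\alpha}_L\in\mathbb{N}^L$ such that $(\boldsymbol{\alpha}_K,\boldsymbol{\alpha}_L)\in\mathcal{A}^{M,p}$ for some $\boldsymbol{\alpha}_K\in\mathbb{N}^K$. For non-empty $\mathbf{u}\subset\{1,\dots,L\}$, $\mathcal{A}_{\mathbf{u},L}^{M,p}=\{\boldsymbol{\alpha}_L\in\mathcal{A}_L:\alpha_k\ne0\Longleftrightarrow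 k\in\mathbf{u}\}$, and $\boldsymbol{\xi}_{\mathbf{u}}=(\xi_k)_{k\in\mathbf{u}}$. Sobol' decomposition (standard definition): for a square-integrable function $f(\boldsymbol{\xi})$ of independent components, it is a representation $f=f_{\boldsymbol{0}}+\sum_{\mathbf{u}\ne\emptyset}f_{\mathbf{u}}(\boldsymbol{\xi}_{\mathbf{u}})$ with $f_{\boldsymbol{0}}$ constant, each $f_{\mathbf{u}}$ square-integrable and depending only on $\boldsymbol{\xi}_{\mathbf{u}}$, and the integral of $f_{\mathbf{u}}$ over $\xi_k$ (with respect to the law of $\xi_k$) equal to zero for every $k\in\mathbf{u}$. With $f=\mathcal{M}^{PC}(\cdot\mid\boldsymbol{\theta})$ and $f_{\mathbf{u}}=\mathcal{M}^{PC}_{\mathbf{u}}(\cdot\mid\boldsymbol{\theta})$, the conditional Sobol' indices are the variance contributions normalized by the total conditional variance: $S_{\mathbf{u}\mid\boldsymbol{\theta}}=\mathrm{Var}[f_{\mathbf{u}}(\boldsymbol{\xi}_{\mathbf{u}})]/\mathrm{Var}[f(\boldsymbol{\xi})]$, $S_{i\mid\boldsymbol{\theta}}=S_{\{i\}\mid\boldsymbol{\theta}}$, and $S^T_{i\mid\boldsymbol{\theta}}=\sum_{\mathbf{u}\ni i}S_{\mathbf{u}\mid\boldsymbol{\theta}}$. *)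

theory Defs
  imports "HOL-Probability.Probability" "HOL-Computational_Algebra.Polynomial"
begin

text \<open>Vectors in \<open>\<real>\<^sup>n\<close> are functions \<open>nat \<Rightarrow> real\<close> of which only the entries in \<open>{1..n}\<close> matter;
  multi-indices in \<open>\<nat>\<^sup>n\<close> are extensional functions on \<open>{1..n}\<close>, so that distinct functions are
  distinct multi-indices.\<close>

definition multi_indices :: "nat \<Rightarrow> (nat \<Rightarrow> nat) set" where
  "multi_indices n = {1..n} \<rightarrow>\<^sub>E UNIV"

definition zero_index :: "nat \<Rightarrow> nat \<Rightarrow> nat" where
  "zero_index n = (\<lambda>i\<in>{1..n}. 0)"

text \<open>An element of \<open>\<nat>\<^sup>K\<^sup>+\<^sup>L\<close> is written as a pair \<open>(a, b)\<close> in \<open>\<nat>\<^sup>K \<times> \<nat>\<^sup>L\<close>.\<close>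

definition trunc_set :: "nat \<Rightarrow> nat \<Rightarrow> nat \<Rightarrow> ((nat \<Rightarrow> nat) \<times> (nat \<Rightarrow> nat)) set" where
  "trunc_set K L p =
     {(a, b) \<in> multi_indices K \<times> multi_indices L. (\<Sum>i=1..K. a i) + (\<Sum>j=1..L. b j) \<le> p}"

definition aleatory_set :: "nat \<Rightarrow> nat \<Rightarrow> nat \<Rightarrow> (nat \<Rightarrow> nat) set" where
  "aleatory_set K L p = {b \<in> multi_indices L. \<exists>a \<in> multi_indices K. (a, b) \<in> trunc_set K L p}"

definition aleatory_set_on :: "nat \<Rightarrow> nat \<Rightarrow> nat \<Rightarrow> nat set \<Rightarrow> (nat \<Rightarrow> nat) set" where
  "aleatory_set_on K L p u =
     {b \<in> aleatory_set K L p. \<forall>k\<in>{1..L}. b k \<noteq> 0 \<longleftrightarrow> k \<in> u}"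


definition orthonormal_polys :: "real measure \<Rightarrow> (nat \<Rightarrow> real poly) \<Rightarrow> bool" where
  "orthonormal_polys \<mu> \<phi> \<longleftrightarrow>
     \<phi> 0 = 1 \<and> (\<forall>k. degree (\<phi> k) = k) \<and>
     (\<forall>j k. integrable \<mu> (\<lambda>t. poly (\<phi> j) t * poly (\<phi> k) t) \<and>
            (\<integral>t. poly (\<phi> j) t * poly (\<phi> k) t \<partial>\<mu>) = (if j = k then 1 else 0))"

definition tensor_poly :: "nat \<Rightarrow> (nat \<Rightarrow> nat \<Rightarrow> real poly) \<Rightarrow> (nat \<Rightarrow> nat) \<Rightarrow> (nat \<Rightarrow> real) \<Rightarrow> real"
  where "tensor_poly n \<phi> a x = (\<Prod>i=1..n. poly (\<phi> i (a i)) (x i))"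

text \<open>In the next two definitions \<open>\<phi>\<close> and \<open>\<psi>\<close> are the univariate families of the epistemic and of
  the aleatory components.\<close>

definition pce ::
  "nat \<Rightarrow> nat \<Rightarrow> nat \<Rightarrow> (nat \<Rightarrow> nat \<Rightarrow> real poly) \<Rightarrow> (nat \<Rightarrow> nat \<Rightarrow> real poly) \<Rightarrow>
   ((nat \<Rightarrow> nat) \<Rightarrow> (nat \<Rightarrow> nat) \<Rightarrow> real) \<Rightarrow> (nat \<Rightarrow> real) \<Rightarrow> (nat \<Rightarrow> real) \<Rightarrow> real" where
  "pce K L p \<phi> \<psi> y \<theta> x =
     (\<Sum>(a, b)\<in>trunc_set K L p. y a b * (tensor_poly K \<phi> a \<theta> * tensor_poly L \<psi> b x))"

definition cond_coeff ::
  "nat \<Rightarrow> nat \<Rightarrow> nat \<Rightarrow> (nat \<Rightarrow> nat \<Rightarrow> real poly) \<Rightarrow>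
   ((nat \<Rightarrow> nat) \<Rightarrow> (nat \<Rightarrow> nat) \<Rightarrow> real) \<Rightarrow> (nat \<Rightarrow> nat) \<Rightarrow> (nat \<Rightarrow> real) \<Rightarrow> real" where
  "cond_coeff K L p \<phi> y b \<theta> =
     (\<Sum>a | (a, b) \<in> trunc_set K L p. y a b * tensor_poly K \<phi> a \<theta>)"


definition joint_law :: "'w measure \<Rightarrow> 'i set \<Rightarrow> ('i \<Rightarrow> 'w \<Rightarrow> real) \<Rightarrow> ('i \<Rightarrow> real) measure" where
  "joint_law P I Z = distr P (Pi\<^sub>M I (\<lambda>_. borel)) (\<lambda>w. \<lambda>i\<in>I. Z i w)"

text \<open>Components \<open>g u\<close> are functions of the whole vector that depend only on the coordinates in
  \<open>u\<close>. As usual for square-integrable functions, the representation and the vanishing of the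
  partial integrals are required almost everywhere (sections of a square-integrable function
  need be integrable only for almost all values of the other variables). Values of \<open>g\<close> at the
  empty set and outside the power set of \<open>I\<close> are irrelevant.\<close>

definition sobol_decomposition ::
  "'w measure \<Rightarrow> 'i set \<Rightarrow> ('i \<Rightarrow> 'w \<Rightarrow> real) \<Rightarrow> (('i \<Rightarrow> real) \<Rightarrow> real) \<Rightarrow>
   real \<Rightarrow> ('i set \<Rightarrow> ('i \<Rightarrow> real) \<Rightarrow> real) \<Rightarrow> bool" where
  "sobol_decomposition P I Z f f0 g \<longleftrightarrow>
     f \<in> borel_measurable (joint_law P I Z) \<and>
     integrable (joint_law P I Z) (\<lambda>x. (f x)\<^sup>2) \<and>
     (AE x in joint_law P I Z. f x = f0 + (\<Sum>u\<in>Pow I - {{}}. g u x)) \<and>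
     (\<forall>u\<in>Pow I - {{}}.
        g u \<in> borel_measurable (joint_law P I Z) \<and>
        integrable (joint_law P I Z) (\<lambda>x. (g u x)\<^sup>2) \<and>
        (\<forall>x\<in>space (joint_law P I Z). \<forall>x'\<in>space (joint_law P I Z).
            (\<forall>k\<in>u. x k = x' k) \<longrightarrow> g u x = g u x') \<and>
        (\<forall>k\<in>u. AE x in joint_law P I Z. (\<integral>t. g u (x(k := t)) \<partial>distr P borel (Z k)) = 0))"

text \<open>The indices are taken relative to the components \<open>g\<close> of a Sobol' decomposition of \<open>f\<close>, and
  \<open>N\<close> is the law of the input vector. If the variance of \<open>f\<close> vanishes, they are \<open>0\<close> because
  of \<open>x / 0 = 0\<close>.\<close>

definition sobol_index ::
  "('i \<Rightarrow> real) measure \<Rightarrow> (('i \<Rightarrow> real) \<Rightarrow> real) \<Rightarrow> ('i set \<Rightarrow> ('i \<Rightarrow> real) \<Rightarrow> real) \<Rightarrow>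
   'i set \<Rightarrow> real" where
  "sobol_index N f g u = prob_space.variance N (g u) / prob_space.variance N f"

definition total_sobol_index ::
  "('i \<Rightarrow> real) measure \<Rightarrow> 'i set \<Rightarrow> (('i \<Rightarrow> real) \<Rightarrow> real) \<Rightarrow>
   ('i set \<Rightarrow> ('i \<Rightarrow> real) \<Rightarrow> real) \<Rightarrow> 'i \<Rightarrow> real" where
  "total_sobol_index N I f g i = (\<Sum>u | u \<subseteq> I \<and> i \<in> u. sobol_index N f g u)"

end

theory Submission
  imports Defs
begin

text \<open>Conditionally on \<open>\<theta>\<close>, the law of the aleatory vector is a product measure. Redrawing one
  coordinate independently preserves this measure; averaging over the redrawn coordinate shows that
  Sobol' components belonging to different sets are orthogonal. Applied to the differences of two
  decompositions this gives uniqueness, since pairwise orthogonal functions whose sum vanishes all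
  vanish. Grouping the expansion by the supports of the multi-indices is a decomposition because
  non-constant orthonormal polynomials have mean zero, and Parseval's identity gives the indices.\<close>

subsection \<open>Sobol' components on a finite product space\<close>

context finite_product_prob_space
begin

section \<open>Redrawing one coordinate of a product measure\<close>

lemma measurable_fun_upd_PiM [measurable]:
  assumes "k \<in> I"
  shows "(\<lambda>(x, t). x(k := t)) \<in> Pi\<^sub>M I M \<Otimes>\<^sub>M M k \<rightarrow>\<^sub>M Pi\<^sub>M I M"
proof -
  have "(\<lambda>z. (fst z)(k := snd z)) \<in> Pi\<^sub>M I M \<Otimes>\<^sub>M M k \<rightarrow>\<^sub>M Pi\<^sub>M I M"
    by (rule measurable_fun_upd[where J = I]) (use assms in auto)
  then show ?thesis by (simp add: case_prod_beta)
qed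

lemma fun_upd_in_space_PiM:
  assumes "k \<in> I" "x \<in> space (Pi\<^sub>M I M)" "t \<in> space (M k)"
  shows "x(k := t) \<in> space (Pi\<^sub>M I M)"
  using assms by (auto simp: space_PiM PiE_iff extensional_def)

text \<open>It suffices to compare boxes. In the preimage of a box the new value \<open>t\<close>
  must lie in \<open>A k\<close>, while the old \<open>k\<close>-th coordinate is free and
  contributes the factor 1.\<close>

lemma distr_fun_upd_PiM:
  assumes k: "k \<in> I"
  shows "distr (Pi\<^sub>M I M \<Otimes>\<^sub>M M k) (Pi\<^sub>M I M) (\<lambda>(x, t). x(k := t)) = Pi\<^sub>M I M"
proof (rule PiM_eqI)
  fix A assume A: "\<And>i. i \<in> I \<Longrightarrow> A i \<in> sets (M i)"
  interpret pair_sigma_finite "Pi\<^sub>M I M" "M k" ..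
  let ?B = "A(k := space (M k))"
  have B: "?B i \<in> sets (M i)" if "i \<in> I" for i using A that by auto
  have sub: "t \<in> space (M i)" if "i \<in> I" "t \<in> A i" for i t
    using sets.sets_into_space[OF A[OF that(1)]] that(2) by blast
  have "emeasure (distr (Pi\<^sub>M I M \<Otimes>\<^sub>M M k) (Pi\<^sub>M I M) (\<lambda>(x, t). x(k := t))) (Pi\<^sub>E I A)
      = emeasure (Pi\<^sub>M I M \<Otimes>\<^sub>M M k)
          ((\<lambda>(x, t). x(k := t)) -` Pi\<^sub>E I A \<inter> space (Pi\<^sub>M I M \<Otimes>\<^sub>M M k))"
    using k A by (intro emeasure_distr measurable_fun_upd_PiM sets_PiM_I_finite finite_index) auto
  also have "(\<lambda>(x, t). x(k := t)) -` Pi\<^sub>E I A \<inter> space (Pi\<^sub>M I M \<Otimes>\<^sub>M M k) = Pi\<^sub>E I ?B \<times> A k"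
    using k sub by (fastforce simp: space_pair_measure space_PiM PiE_iff extensional_def
      split: if_splits)
  also have "emeasure (Pi\<^sub>M I M \<Otimes>\<^sub>M M k) \<dots> = (\<Prod>i\<in>I. emeasure (M i) (?B i)) * emeasure (M k) (A k)"
    using k A B by (subst M.emeasure_pair_measure_Times)
      (auto intro!: sets_PiM_I_finite finite_index simp: measure_times simp del: fun_upd_apply)
  also have "(\<Prod>i\<in>I. emeasure (M i) (?B i)) = (\<Prod>i\<in>I - {k}. emeasure (M i) (A i))"
    using k by (subst prod.remove[OF finite_index k]) (simp add: M.emeasure_space_1)
  also have "\<dots> * emeasure (M k) (A k) = (\<Prod>i\<in>I. emeasure (M i) (A i))"
    using k by (subst prod.remove[OF finite_index k]) (simp add: mult.commute)
  finally show "emeasure (distr (Pi\<^sub>M I M \<Otimes>\<^sub>M M k) (Pi\<^sub>M I M) (\<lambda>(x, t). x(k := t))) (Pi\<^sub>E I A)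
      = (\<Prod>i\<in>I. emeasure (M i) (A i))" .
qed (auto simp: finite_index)

text \<open>Fubini on the pair of \<open>x\<close> and the redrawn \<open>t\<close>. Integrating
  over all of \<open>x\<close>, its overwritten coordinate included, makes it unnecessary to split
  the product at \<open>k\<close>.\<close>

lemma
  fixes f :: "('a \<Rightarrow> 'b) \<Rightarrow> real"
  assumes k: "k \<in> I" and f: "integrable (Pi\<^sub>M I M) f"
  shows AE_integrable_fun_upd: "AE x in Pi\<^sub>M I M. integrable (M k) (\<lambda>t. f (x(k := t)))"
    and integral_fun_upd: "(\<integral>x. (\<integral>t. f (x(k := t)) \<partial>M k) \<partial>Pi\<^sub>M I M) = (\<integral>x. f x \<partial>Pi\<^sub>M I M)"
proof -
  interpret pair_sigma_finite "Pi\<^sub>M I M" "M k" ..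
  note [measurable] = measurable_fun_upd_PiM[OF k] borel_measurable_integrable[OF f]
  have "integrable (distr (Pi\<^sub>M I M \<Otimes>\<^sub>M M k) (Pi\<^sub>M I M) (\<lambda>(x, t). x(k := t))) f"
    using f by (simp only: distr_fun_upd_PiM[OF k])
  from integrable_distr[OF measurable_fun_upd_PiM[OF k] this]
  have *: "integrable (Pi\<^sub>M I M \<Otimes>\<^sub>M M k) (\<lambda>(x, t). f (x(k := t)))"
    by (simp add: case_prod_unfold)
  show "AE x in Pi\<^sub>M I M. integrable (M k) (\<lambda>t. f (x(k := t)))"
    using AE_integrable_fst'[OF *] by simp
  show "(\<integral>x. (\<integral>t. f (x(k := t)) \<partial>M k) \<partial>Pi\<^sub>M I M) = (\<integral>x. f x \<partial>Pi\<^sub>M I M)"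
    using integral_fst'[OF *]
    by (subst (2) distr_fun_upd_PiM[OF k, symmetric], subst integral_distr)
      (auto simp: case_prod_unfold)
qed

text \<open>These are the conditions that \<open>sobol_decomposition\<close> puts on a single
  component, stated with the coordinate laws \<open>M k\<close> of the product.\<close>

definition sobol_component :: "'a set \<Rightarrow> (('a \<Rightarrow> 'b) \<Rightarrow> real) \<Rightarrow> bool" where
  "sobol_component u f \<longleftrightarrow>
     f \<in> borel_measurable (Pi\<^sub>M I M) \<and> integrable (Pi\<^sub>M I M) (\<lambda>x. (f x)\<^sup>2) \<and>
     (\<forall>x\<in>space (Pi\<^sub>M I M). \<forall>x'\<in>space (Pi\<^sub>M I M). (\<forall>k\<in>u. x k = x' k) \<longrightarrow> f x = f x') \<and>
     (\<forall>k\<in>u. AE x in Pi\<^sub>M I M. (\<integral>t. f (x(k := t)) \<partial>M k) = 0)"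

section \<open>Differences and orthogonality of components\<close>

lemma integrable_mult_of_square:
  fixes f g :: "('a \<Rightarrow> 'b) \<Rightarrow> real"
  assumes [measurable]: "f \<in> borel_measurable (Pi\<^sub>M I M)" "g \<in> borel_measurable (Pi\<^sub>M I M)"
    and "integrable (Pi\<^sub>M I M) (\<lambda>x. (f x)\<^sup>2)" "integrable (Pi\<^sub>M I M) (\<lambda>x. (g x)\<^sup>2)"
  shows "integrable (Pi\<^sub>M I M) (\<lambda>x. f x * g x)"
proof (rule Bochner_Integration.integrable_bound)
  show "integrable (Pi\<^sub>M I M) (\<lambda>x. (f x)\<^sup>2 + (g x)\<^sup>2)" using assms by simp
  have "\<bar>f x * g x\<bar> \<le> (f x)\<^sup>2 + (g x)\<^sup>2" for x
  proof -
    have "2 * \<bar>f x\<bar> * \<bar>g x\<bar> \<le> (f x)\<^sup>2 + (g x)\<^sup>2"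
      using sum_squares_bound[of "\<bar>f x\<bar>" "\<bar>g x\<bar>"] by simp
    moreover have "0 \<le> \<bar>f x\<bar> * \<bar>g x\<bar>" by simp
    ultimately show ?thesis by (simp only: abs_mult mult.assoc)
  qed
  then show "AE x in Pi\<^sub>M I M. norm (f x * g x) \<le> norm ((f x)\<^sup>2 + (g x)\<^sup>2)" by simp
qed simp

text \<open>The constant 1 is square-integrable because the measure is finite.\<close>

lemma integrable_of_square:
  fixes f :: "('a \<Rightarrow> 'b) \<Rightarrow> real"
  assumes "f \<in> borel_measurable (Pi\<^sub>M I M)" "integrable (Pi\<^sub>M I M) (\<lambda>x. (f x)\<^sup>2)"
  shows "integrable (Pi\<^sub>M I M) f"
  using integrable_mult_of_square[of f "\<lambda>_. 1"] assms by simp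

lemma sobol_component_diff:
  assumes f: "sobol_component u f" and g: "sobol_component u g" and u: "u \<subseteq> I"
  shows "sobol_component u (\<lambda>x. f x - g x)"
  unfolding sobol_component_def
proof (intro conjI ballI impI)
  have [measurable]: "f \<in> borel_measurable (Pi\<^sub>M I M)" "g \<in> borel_measurable (Pi\<^sub>M I M)"
    and sq: "integrable (Pi\<^sub>M I M) (\<lambda>x. (f x)\<^sup>2)" "integrable (Pi\<^sub>M I M) (\<lambda>x. (g x)\<^sup>2)"
    using f g by (auto simp: sobol_component_def)
  show "(\<lambda>x. f x - g x) \<in> borel_measurable (Pi\<^sub>M I M)" by simp
  have "integrable (Pi\<^sub>M I M) (\<lambda>x. (f x)\<^sup>2 + (g x)\<^sup>2 - 2 * (f x * g x))"
    using sq integrable_mult_of_square[of f g] by simp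
  then show "integrable (Pi\<^sub>M I M) (\<lambda>x. (f x - g x)\<^sup>2)"
    by (simp add: power2_diff mult.assoc)
  show "f x - g x = f x' - g x'"
    if "x \<in> space (Pi\<^sub>M I M)" "x' \<in> space (Pi\<^sub>M I M)" "\<forall>k\<in>u. x k = x' k" for x x'
    using f g that unfolding sobol_component_def by metis
  fix k assume k: "k \<in> u"
  \<comment> \<open>The integral of a non-integrable section is 0 by default, so vanishing partial
    integrals can be subtracted only where both sections are integrable, which is almost
    everywhere.\<close>
  have "AE x in Pi\<^sub>M I M. integrable (M k) (\<lambda>t. f (x(k := t)))"
    "AE x in Pi\<^sub>M I M. integrable (M k) (\<lambda>t. g (x(k := t)))"
    using k u sq by (auto intro!: AE_integrable_fun_upd integrable_of_square)
  moreover have "AE x in Pi\<^sub>M I M. (\<integral>t. f (x(k := t)) \<partial>M k) = 0"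
    "AE x in Pi\<^sub>M I M. (\<integral>t. g (x(k := t)) \<partial>M k) = 0"
    using f g k by (auto simp: sobol_component_def)
  ultimately show "AE x in Pi\<^sub>M I M. (\<integral>t. f (x(k := t)) - g (x(k := t)) \<partial>M k) = 0"
    by eventually_elim simp
qed

lemma sobol_component_orthogonal:
  assumes f: "sobol_component u f" and k: "k \<in> u" "k \<in> I"
    and g: "integrable (Pi\<^sub>M I M) (\<lambda>x. (g x)\<^sup>2)" "g \<in> borel_measurable (Pi\<^sub>M I M)"
    and indep: "\<And>x t. x \<in> space (Pi\<^sub>M I M) \<Longrightarrow> t \<in> space (M k) \<Longrightarrow> g (x(k := t)) = g x"
  shows "(\<integral>x. f x * g x \<partial>Pi\<^sub>M I M) = 0"
proof -
  have "integrable (Pi\<^sub>M I M) (\<lambda>x. f x * g x)"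
    using f g by (intro integrable_mult_of_square) (auto simp: sobol_component_def)
  from integral_fun_upd[OF k(2) this]
  have "(\<integral>x. f x * g x \<partial>Pi\<^sub>M I M) = (\<integral>x. (\<integral>t. f (x(k := t)) * g (x(k := t)) \<partial>M k) \<partial>Pi\<^sub>M I M)"
    by (rule sym)
  also have "\<dots> = (\<integral>x. (\<integral>t. f (x(k := t)) \<partial>M k) * g x \<partial>Pi\<^sub>M I M)"
    by (intro Bochner_Integration.integral_cong refl)
      (simp add: indep cong: Bochner_Integration.integral_cong)
  also have "\<dots> = 0"
  proof (rule integral_eq_zero_AE)
    have "AE x in Pi\<^sub>M I M. (\<integral>t. f (x(k := t)) \<partial>M k) = 0"
      using f k by (auto simp: sobol_component_def)
    then show "AE x in Pi\<^sub>M I M. (\<integral>t. f (x(k := t)) \<partial>M k) * g x = 0" by eventually_elim simp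
  qed
  finally show ?thesis .
qed

text \<open>Some \<open>k\<close> lies in exactly one of the two sets: averaging over it kills the
  component whose set contains \<open>k\<close> and leaves the other one unchanged. The inner fact
  is general in both functions so as to serve both cases.\<close>

lemma sobol_components_orthogonal:
  assumes f: "sobol_component u f" and g: "sobol_component v g" and "u \<subseteq> I" "v \<subseteq> I" "u \<noteq> v"
  shows "(\<integral>x. f x * g x \<partial>Pi\<^sub>M I M) = 0"
proof -
  have *: "(\<integral>x. f x * g x \<partial>Pi\<^sub>M I M) = 0"
    if "sobol_component u f" "sobol_component v g" "k \<in> u" "k \<notin> v" "k \<in> I" for u v f g k
  proof (rule sobol_component_orthogonal[OF that(1,3,5)])
    show "g (x(k := t)) = g x" if "x \<in> space (Pi\<^sub>M I M)" "t \<in> space (M k)" for x t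
      using \<open>sobol_component v g\<close> \<open>k \<notin> v\<close> fun_upd_in_space_PiM[OF \<open>k \<in> I\<close> that] that(1)
      unfolding sobol_component_def by (metis fun_upd_other)
  qed (use that in \<open>auto simp: sobol_component_def\<close>)
  from assms(5) consider k where "k \<in> u" "k \<notin> v" | k where "k \<in> v" "k \<notin> u" by auto
  then show ?thesis
  proof cases
    case 1 then show ?thesis using *[OF f g] assms(3) by auto
  next
    case 2 then show ?thesis using *[OF g f] assms(4) by (auto simp: mult.commute)
  qed
qed

lemma integral_sobol_component:
  assumes "sobol_component u f" "u \<subseteq> I" "u \<noteq> {}"
  shows "(\<integral>x. f x \<partial>Pi\<^sub>M I M) = 0"
proof -
  obtain k where "k \<in> u" using assms by auto
  then show ?thesis using sobol_component_orthogonal[OF assms(1), of k "\<lambda>_. 1"] assms by auto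
qed

text \<open>This is the core of uniqueness. Integrating the sum isolates \<open>h0\<close>;
  integrating it against one component isolates the squared norm of that component.\<close>

lemma sobol_components_sum_zero:
  assumes h: "\<And>u. u \<in> Pow I - {{}} \<Longrightarrow> sobol_component u (h u)"
    and 0: "AE x in Pi\<^sub>M I M. h0 + (\<Sum>u\<in>Pow I - {{}}. h u x) = 0"
  shows "h0 = 0" and "u \<in> Pow I - {{}} \<Longrightarrow> AE x in Pi\<^sub>M I M. h u x = 0"
proof -
  let ?U = "Pow I - {{}}"
  note meas = h[unfolded sobol_component_def, THEN conjunct1]
  note sq = h[unfolded sobol_component_def, THEN conjunct2, THEN conjunct1]
  note int = integrable_of_square[OF meas sq]
  have "0 = (\<integral>x. h0 + (\<Sum>u\<in>?U. h u x) \<partial>Pi\<^sub>M I M)"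
    by (rule integral_eq_zero_AE[OF 0, symmetric])
  also have "\<dots> = h0 + (\<Sum>u\<in>?U. (\<integral>x. h u x \<partial>Pi\<^sub>M I M))"
    using int P.prob_space
    by (subst Bochner_Integration.integral_add)
      (auto simp: Bochner_Integration.integral_sum intro!: Bochner_Integration.integrable_sum)
  also have "(\<Sum>u\<in>?U. (\<integral>x. h u x \<partial>Pi\<^sub>M I M)) = 0"
    by (intro sum.neutral ballI integral_sobol_component[OF h]) auto
  also have "h0 + 0 = h0" by simp
  finally show "h0 = 0" ..
  have AE0: "AE x in Pi\<^sub>M I M. (\<Sum>u\<in>?U. h u x) = 0" using 0 \<open>h0 = 0\<close> by simp
  fix v assume v: "v \<in> ?U"
  \<comment> \<open>The vanishing sum is multiplied by \<open>h v\<close>; orthogonality then leaves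
    only the diagonal term.\<close>
  have "0 = (\<integral>x. (\<Sum>u\<in>?U. h v x * h u x) \<partial>Pi\<^sub>M I M)"
    by (rule integral_eq_zero_AE[symmetric], use AE0 in eventually_elim)
      (simp flip: sum_distrib_left)
  also have "\<dots> = (\<Sum>u\<in>?U. (\<integral>x. h v x * h u x \<partial>Pi\<^sub>M I M))"
    by (intro Bochner_Integration.integral_sum integrable_mult_of_square meas sq v)
  also have "\<dots> = (\<Sum>u\<in>?U. if u = v then (\<integral>x. (h v x)\<^sup>2 \<partial>Pi\<^sub>M I M) else 0)"
    using v by (intro sum.cong refl)
      (auto simp: power2_eq_square sobol_components_orthogonal[OF h h])
  also have "\<dots> = (\<integral>x. (h v x)\<^sup>2 \<partial>Pi\<^sub>M I M)"
    using v finite_index by simp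
  finally show "AE x in Pi\<^sub>M I M. h v x = 0"
    using integral_nonneg_eq_0_iff_AE[OF sq[OF v]] by simp
qed

end

subsection \<open>Tensor products of orthonormal polynomials\<close>

locale orthonormal_tensor = finite_product_prob_space M "{1..n}"
  for M :: "nat \<Rightarrow> real measure" and n +
  fixes \<psi> :: "nat \<Rightarrow> nat \<Rightarrow> real poly"
  assumes orthonormal: "\<And>i. i \<in> {1..n} \<Longrightarrow> orthonormal_polys (M i) (\<psi> i)"
begin

text \<open>The integral factorizes over the coordinates. Multi-indices are extensional, so two
  distinct ones differ at some coordinate in \<open>{1..n}\<close>, and that factor is zero.\<close>

lemma
  assumes "a \<in> multi_indices n" "b \<in> multi_indices n"
  shows integrable_tensor_poly_mult:
      "integrable (Pi\<^sub>M {1..n} M) (\<lambda>x. tensor_poly n \<psi> a x * tensor_poly n \<psi> b x)"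
    and integral_tensor_poly_mult:
      "(\<integral>x. tensor_poly n \<psi> a x * tensor_poly n \<psi> b x \<partial>Pi\<^sub>M {1..n} M) = (if a = b then 1 else 0)"
proof -
  have *: "integrable (M i) (\<lambda>t. poly (\<psi> i (a i)) t * poly (\<psi> i (b i)) t)"
    "(\<integral>t. poly (\<psi> i (a i)) t * poly (\<psi> i (b i)) t \<partial>M i) = (if a i = b i then 1 else 0)"
    if "i \<in> {1..n}" for i
    using orthonormal[OF that] by (auto simp: orthonormal_polys_def)
  have eq: "tensor_poly n \<psi> a x * tensor_poly n \<psi> b x
      = (\<Prod>i\<in>{1..n}. poly (\<psi> i (a i)) (x i) * poly (\<psi> i (b i)) (x i))" for x
    by (simp add: tensor_poly_def prod.distrib)
  show "integrable (Pi\<^sub>M {1..n} M) (\<lambda>x. tensor_poly n \<psi> a x * tensor_poly n \<psi> b x)"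
    unfolding eq using * by (intro product_integrable_prod) auto
  have "(\<integral>x. tensor_poly n \<psi> a x * tensor_poly n \<psi> b x \<partial>Pi\<^sub>M {1..n} M)
      = (\<Prod>i\<in>{1..n}. if a i = b i then 1 else 0)"
    unfolding eq using * by (subst product_integral_prod) auto
  also have "\<dots> = (if a = b then 1 else 0)"
  proof (cases "a = b")
    case False
    then obtain i where "i \<in> {1..n}" "a i \<noteq> b i"
      using assms by (metis PiE_ext multi_indices_def)
    then show ?thesis using False by (auto intro!: prod_zero)
  qed simp
  finally show "(\<integral>x. tensor_poly n \<psi> a x * tensor_poly n \<psi> b x \<partial>Pi\<^sub>M {1..n} M)
      = (if a = b then 1 else 0)" .
qed

lemma zero_index_in_multi_indices [simp]: "zero_index n \<in> multi_indices n"
  by (simp add: zero_index_def multi_indices_def)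

lemma tensor_poly_zero_index: "tensor_poly n \<psi> (zero_index n) x = 1"
  using orthonormal by (simp add: tensor_poly_def zero_index_def orthonormal_polys_def)

text \<open>This is orthonormality against the tensor polynomial of the zero index, the constant
  1.\<close>

lemma
  assumes "b \<in> multi_indices n"
  shows integrable_tensor_poly: "integrable (Pi\<^sub>M {1..n} M) (tensor_poly n \<psi> b)"
    and integral_tensor_poly:
      "(\<integral>x. tensor_poly n \<psi> b x \<partial>Pi\<^sub>M {1..n} M) = (if b = zero_index n then 1 else 0)"
  using integrable_tensor_poly_mult[OF assms zero_index_in_multi_indices]
    integral_tensor_poly_mult[OF assms zero_index_in_multi_indices]
  by (simp_all add: tensor_poly_zero_index)

section \<open>Finite linear combinations of tensor polynomials\<close>

context
  fixes B :: "(nat \<Rightarrow> nat) set" and d :: "(nat \<Rightarrow> nat) \<Rightarrow> real"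
  assumes B: "finite B" "B \<subseteq> multi_indices n"
begin

lemma borel_measurable_tensor_sum:
  "(\<lambda>x. \<Sum>b\<in>B. d b * tensor_poly n \<psi> b x) \<in> borel_measurable (Pi\<^sub>M {1..n} M)"
  using B integrable_tensor_poly[THEN borel_measurable_integrable]
  by (intro borel_measurable_sum borel_measurable_times) auto

text \<open>Parseval's identity: the square expands into a double sum whose off-diagonal terms
  integrate to zero.\<close>

lemma
  shows integrable_tensor_sum_square:
      "integrable (Pi\<^sub>M {1..n} M) (\<lambda>x. (\<Sum>b\<in>B. d b * tensor_poly n \<psi> b x)\<^sup>2)"
    and integral_tensor_sum_square:
      "(\<integral>x. (\<Sum>b\<in>B. d b * tensor_poly n \<psi> b x)\<^sup>2 \<partial>Pi\<^sub>M {1..n} M) = (\<Sum>b\<in>B. (d b)\<^sup>2)"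
proof -
  let ?T = "tensor_poly n \<psi>"
  have eq: "(\<Sum>b\<in>B. d b * ?T b x)\<^sup>2 = (\<Sum>a\<in>B. \<Sum>b\<in>B. d a * d b * (?T a x * ?T b x))" for x
    by (simp add: power2_eq_square sum_product mult_ac)
  have int: "integrable (Pi\<^sub>M {1..n} M) (\<lambda>x. ?T a x * ?T b x)" if "a \<in> B" "b \<in> B" for a b
    using that B by (intro integrable_tensor_poly_mult) auto
  show "integrable (Pi\<^sub>M {1..n} M) (\<lambda>x. (\<Sum>b\<in>B. d b * ?T b x)\<^sup>2)"
    unfolding eq using int by (intro Bochner_Integration.integrable_sum integrable_mult_right) auto
  have "(\<integral>x. (\<Sum>b\<in>B. d b * ?T b x)\<^sup>2 \<partial>Pi\<^sub>M {1..n} M)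
      = (\<Sum>a\<in>B. \<Sum>b\<in>B. d a * d b * (\<integral>x. ?T a x * ?T b x \<partial>Pi\<^sub>M {1..n} M))"
    unfolding eq using int by (simp add: Bochner_Integration.integral_sum)
  also have "\<dots> = (\<Sum>a\<in>B. \<Sum>b\<in>B. if b = a then (d a)\<^sup>2 else 0)"
    using B by (intro sum.cong refl) 
      (auto simp: subset_iff integral_tensor_poly_mult power2_eq_square simp del: One_nat_def)
  also have "\<dots> = (\<Sum>b\<in>B. (d b)\<^sup>2)"
    using B by simp
  finally show "(\<integral>x. (\<Sum>b\<in>B. d b * ?T b x)\<^sup>2 \<partial>Pi\<^sub>M {1..n} M) = (\<Sum>b\<in>B. (d b)\<^sup>2)" .
qed

lemma integral_tensor_sum:
  "(\<integral>x. (\<Sum>b\<in>B. d b * tensor_poly n \<psi> b x) \<partial>Pi\<^sub>M {1..n} M)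
    = (if zero_index n \<in> B then d (zero_index n) else 0)"
proof -
  have "(\<integral>x. (\<Sum>b\<in>B. d b * tensor_poly n \<psi> b x) \<partial>Pi\<^sub>M {1..n} M)
      = (\<Sum>b\<in>B. d b * (\<integral>x. tensor_poly n \<psi> b x \<partial>Pi\<^sub>M {1..n} M))"
    using B integrable_tensor_poly by (subst Bochner_Integration.integral_sum) auto
  also have "\<dots> = (\<Sum>b\<in>B. if b = zero_index n then d b else 0)"
    using B by (intro sum.cong refl) (auto simp: subset_iff integral_tensor_poly simp del: One_nat_def)
  finally show ?thesis using B by simp
qed

text \<open>Outside \<open>u\<close> every factor has degree 0 and equals 1; inside \<open>u\<close>
  every factor has positive degree and hence mean zero. The partial integrals therefore vanish at
  every point, not only almost everywhere.\<close>

lemma sobol_component_tensor_sum: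
  assumes u: "u \<subseteq> {1..n}" and supp: "\<And>b k. b \<in> B \<Longrightarrow> k \<in> {1..n} \<Longrightarrow> b k \<noteq> 0 \<longleftrightarrow> k \<in> u"
  shows "sobol_component u (\<lambda>x. \<Sum>b\<in>B. d b * tensor_poly n \<psi> b x)"
  unfolding sobol_component_def
proof (intro conjI ballI impI borel_measurable_tensor_sum integrable_tensor_sum_square)
  fix x x' :: "nat \<Rightarrow> real" assume eq: "\<forall>k\<in>u. x k = x' k"
  have "tensor_poly n \<psi> b x = tensor_poly n \<psi> b x'" if "b \<in> B" for b
    unfolding tensor_poly_def
  proof (intro prod.cong refl)
    fix i assume i: "i \<in> {1..n}"
    show "poly (\<psi> i (b i)) (x i) = poly (\<psi> i (b i)) (x' i)"
    proof (cases "i \<in> u")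
      case False
      then have "\<psi> i (b i) = 1"
        using supp[OF that i] orthonormal[OF i] by (simp add: orthonormal_polys_def)
      then show ?thesis by simp
    qed (use eq in simp)
  qed
  then show "(\<Sum>b\<in>B. d b * tensor_poly n \<psi> b x) = (\<Sum>b\<in>B. d b * tensor_poly n \<psi> b x')" by simp
next
  fix k assume k: "k \<in> u"
  then have kn: "k \<in> {1..n}" using u by auto
  \<comment> \<open>The mean of a basis polynomial is its inner product with
    \<open>\<psi> k 0 = 1\<close>.\<close>
  have int: "integrable (M k) (\<lambda>t. poly (\<psi> k j) t)"
    "(\<integral>t. poly (\<psi> k j) t \<partial>M k) = (if j = 0 then 1 else 0)" for j
  proof -
    have "\<psi> k 0 = 1" "integrable (M k) (\<lambda>t. poly (\<psi> k j) t * poly (\<psi> k 0) t)"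
      "(\<integral>t. poly (\<psi> k j) t * poly (\<psi> k 0) t \<partial>M k) = (if j = 0 then 1 else 0)"
      using orthonormal[OF kn] unfolding orthonormal_polys_def by blast+
    then show "integrable (M k) (\<lambda>t. poly (\<psi> k j) t)"
      "(\<integral>t. poly (\<psi> k j) t \<partial>M k) = (if j = 0 then 1 else 0)" by simp_all
  qed
  have eq: "tensor_poly n \<psi> b (x(k := t)) = (\<Prod>i\<in>{1..n} - {k}. poly (\<psi> i (b i)) (x i)) * poly (\<psi> k (b k)) t"
    for b x t
    unfolding tensor_poly_def by (subst prod.remove[OF _ kn]) (auto simp: mult.commute)
  have "(\<integral>t. (\<Sum>b\<in>B. d b * tensor_poly n \<psi> b (x(k := t))) \<partial>M k) = 0" for x
  proof -
    have "(\<integral>t. (\<Sum>b\<in>B. d b * tensor_poly n \<psi> b (x(k := t))) \<partial>M k)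
        = (\<Sum>b\<in>B. d b * ((\<Prod>i\<in>{1..n} - {k}. poly (\<psi> i (b i)) (x i)) *
            (\<integral>t. poly (\<psi> k (b k)) t \<partial>M k)))"
      unfolding eq using int by (subst Bochner_Integration.integral_sum) auto
    also have "\<dots> = 0"
    proof (intro sum.neutral ballI)
      fix b assume "b \<in> B"
      then have "b k \<noteq> 0" using supp[OF _ kn] k by blast
      then show "d b * ((\<Prod>i\<in>{1..n} - {k}. poly (\<psi> i (b i)) (x i)) *
          (\<integral>t. poly (\<psi> k (b k)) t \<partial>M k)) = 0" by (simp add: int)
    qed
    finally show ?thesis .
  qed
  then show "AE x in Pi\<^sub>M {1..n} M. (\<integral>t. (\<Sum>b\<in>B. d b * tensor_poly n \<psi> b (x(k := t))) \<partial>M k) = 0"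
    by simp
qed

end

end

subsection \<open>Index sets\<close>

text \<open>No entry exceeds the total degree, so the set lies in a finite box.\<close>

lemma finite_trunc_set: "finite (trunc_set K L p)"
proof (rule finite_subset)
  have le: "a i \<le> (\<Sum>i=1..n. a i)" if "i \<in> {1..n}" for n i and a :: "nat \<Rightarrow> nat"
    using that by (intro member_le_sum) auto
  show "trunc_set K L p \<subseteq> ({1..K} \<rightarrow>\<^sub>E {..p}) \<times> ({1..L} \<rightarrow>\<^sub>E {..p})"
  proof (rule subrelI)
    fix a b assume "(a, b) \<in> trunc_set K L p"
    then have ab: "a \<in> {1..K} \<rightarrow>\<^sub>E UNIV" "b \<in> {1..L} \<rightarrow>\<^sub>E UNIV"
      and sum: "(\<Sum>i=1..K. a i) + (\<Sum>j=1..L. b j) \<le> p"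
      by (auto simp: trunc_set_def multi_indices_def)
    have "a i \<le> p" if "i \<in> {1..K}" for i
      using le[OF that, of a] sum by linarith
    moreover have "b j \<le> p" if "j \<in> {1..L}" for j
      using le[OF that, of b] sum by linarith
    ultimately show "(a, b) \<in> ({1..K} \<rightarrow>\<^sub>E {..p}) \<times> ({1..L} \<rightarrow>\<^sub>E {..p})"
      using ab by (simp add: PiE_iff)
  qed
  show "finite (({1..K} \<rightarrow>\<^sub>E {..p}) \<times> ({1..L} \<rightarrow>\<^sub>E {..p}))"
    by (intro finite_cartesian_product finite_PiE) auto
qed

lemma aleatory_set_eq_image: "aleatory_set K L p = snd ` trunc_set K L p"
  by (force simp: aleatory_set_def trunc_set_def)

lemma finite_aleatory_set: "finite (aleatory_set K L p)"
  by (simp add: aleatory_set_eq_image finite_trunc_set)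

lemma zero_index_in_aleatory_set: "zero_index L \<in> aleatory_set K L p"
  by (auto simp: aleatory_set_def trunc_set_def zero_index_def multi_indices_def
      intro!: bexI[of _ "zero_index K"])

text \<open>This presents the set as a fibre of the support map, the form needed to group sums. The
  zero index may be removed because \<open>u\<close> is non-empty.\<close>

lemma aleatory_set_on_eq:
  assumes "u \<in> Pow {1..L} - {{}}"
  shows "aleatory_set_on K L p u =
    {b \<in> aleatory_set K L p - {zero_index L}. {k\<in>{1..L}. b k \<noteq> 0} = u}"
  using assms by (auto simp: aleatory_set_on_def zero_index_def)

text \<open>The non-empty supports partition the nonzero indices; by extensionality, an index with
  empty support is the zero index.\<close>

lemma sum_aleatory_set_on:
  fixes h :: "(nat \<Rightarrow> nat) \<Rightarrow> real"
  shows "(\<Sum>u\<in>Pow {1..L} - {{}}. \<Sum>b\<in>aleatory_set_on K L p u. h b)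
    = (\<Sum>b\<in>aleatory_set K L p - {zero_index L}. h b)"
proof -
  have "{k\<in>{1..L}. b k \<noteq> 0} \<noteq> {}" if "b \<in> aleatory_set K L p" "b \<noteq> zero_index L" for b
  proof -
    have "b \<in> {1..L} \<rightarrow>\<^sub>E UNIV" "zero_index L \<in> {1..L} \<rightarrow>\<^sub>E UNIV"
      using that by (auto simp: aleatory_set_def multi_indices_def zero_index_def)
    then obtain k where "k \<in> {1..L}" "b k \<noteq> zero_index L k"
      using \<open>b \<noteq> zero_index L\<close> by (metis PiE_ext)
    then show ?thesis by (auto simp: zero_index_def)
  qed
  then have "(\<Sum>u\<in>Pow {1..L} - {{}}. \<Sum>b\<in>{b \<in> aleatory_set K L p - {zero_index L}. {k\<in>{1..L}. b k \<noteq> 0} = u}. h b)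
    = (\<Sum>b\<in>aleatory_set K L p - {zero_index L}. h b)"
    by (intro sum.group) (auto simp: finite_aleatory_set)
  then show ?thesis by (simp only: aleatory_set_on_eq cong: sum.cong)
qed

text \<open>This is the grouping by supports again, now restricted to supports that contain
  \<open>i\<close>; it yields the numerator of the total index.\<close>

lemma sum_aleatory_set_on_containing:
  fixes h :: "(nat \<Rightarrow> nat) \<Rightarrow> real"
  assumes "i \<in> {1..L}"
  shows "(\<Sum>u | u \<subseteq> {1..L} \<and> i \<in> u. \<Sum>b\<in>aleatory_set_on K L p u. h b)
    = (\<Sum>b\<in>{b\<in>aleatory_set K L p. b i \<noteq> 0}. h b)"
proof -
  have "aleatory_set_on K L p u =
      {b \<in> {b\<in>aleatory_set K L p. b i \<noteq> 0}. {k\<in>{1..L}. b k \<noteq> 0} = u}"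
    if "u \<subseteq> {1..L}" "i \<in> u" for u
    using that by (auto simp: aleatory_set_on_def)
  then have "(\<Sum>u | u \<subseteq> {1..L} \<and> i \<in> u. \<Sum>b\<in>aleatory_set_on K L p u. h b)
    = (\<Sum>u | u \<subseteq> {1..L} \<and> i \<in> u.
        \<Sum>b\<in>{b \<in> {b\<in>aleatory_set K L p. b i \<noteq> 0}. {k\<in>{1..L}. b k \<noteq> 0} = u}. h b)"
    by (intro sum.cong) auto
  also have "\<dots> = (\<Sum>b\<in>{b\<in>aleatory_set K L p. b i \<noteq> 0}. h b)"
    using assms by (intro sum.group) (auto simp: finite_aleatory_set)
  finally show ?thesis .
qed

lemma pce_eq_sum_cond_coeff:
  "pce K L p \<phi> \<psi> y \<theta> x =
    (\<Sum>b\<in>aleatory_set K L p. cond_coeff K L p \<phi> y b \<theta> * tensor_poly L \<psi> b x)"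
proof -
  let ?h = "\<lambda>a b. y a b * tensor_poly K \<phi> a \<theta> * tensor_poly L \<psi> b x"
  have "pce K L p \<phi> \<psi> y \<theta> x = (\<Sum>(a, b)\<in>trunc_set K L p. ?h a b)"
    by (simp add: pce_def mult.assoc)
  \<comment> \<open>The pairs are grouped by their aleatory part; each fibre is then indexed by the
    epistemic part alone.\<close>
  also have "\<dots> = (\<Sum>b\<in>aleatory_set K L p. \<Sum>z\<in>{z\<in>trunc_set K L p. snd z = b}. case z of (a, b) \<Rightarrow> ?h a b)"
    by (rule sum.group[symmetric])
      (auto simp: finite_trunc_set finite_aleatory_set aleatory_set_eq_image)
  also have "\<dots> = (\<Sum>b\<in>aleatory_set K L p. \<Sum>a | (a, b) \<in> trunc_set K L p. ?h a b)"
    by (intro sum.cong refl sum.reindex_bij_witness[where i = "\<lambda>a. (a, _)" and j = fst]) auto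
  finally show ?thesis by (simp add: cond_coeff_def sum_distrib_right)
qed

subsection \<open>The law of the input vector\<close>

text \<open>A finite subfamily of \<open>Y\<close> is a finite subfamily of the combined family
  along \<open>Inr\<close>, so the product formula carries over.\<close>

lemma (in prob_space) indep_vars_case_sum_Inr:
  assumes "indep_vars (\<lambda>_. N) (case_sum X Y) (I <+> J)"
  shows "indep_vars (\<lambda>_. N) Y J"
  unfolding indep_vars_def2
proof (intro conjI ballI indep_setsI)
  let ?F = "\<lambda>i. {case_sum X Y i -` A \<inter> space M |A. A \<in> sets N}"
  have F: "indep_sets ?F (I <+> J)" and rv: "\<And>j. j \<in> J \<Longrightarrow> random_variable N (Y j)"
    using assms by (auto simp: indep_vars_def2 elim: ballE[of _ _ "Inr _"])
  show rvY: "random_variable N (Y j)" if "j \<in> J" for j using rv that .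
  show "{Y j -` A \<inter> space M |A. A \<in> sets N} \<subseteq> events" if "j \<in> J" for j
    using rv[OF that] by (auto simp: measurable_def)
  fix A J' assume J': "J' \<noteq> {}" "J' \<subseteq> J" "finite J'"
    and A: "\<forall>j\<in>J'. A j \<in> {Y j -` A \<inter> space M |A. A \<in> sets N}"
  have "\<forall>j\<in>Inr ` J'. (A \<circ> projr) j \<in> ?F j" "Inr ` J' \<subseteq> I <+> J"
    using A J' by auto
  from indep_setsD[OF F this(2) _ _ this(1)] J' show "prob (\<Inter>j\<in>J'. A j) = (\<Prod>j\<in>J'. prob (A j))"
    by (simp add: prod.reindex image_image)
qed

lemma (in prob_space) joint_law_eq_PiM:
  assumes "indep_vars (\<lambda>_. borel) Z I"
  shows "joint_law M I Z = Pi\<^sub>M I (\<lambda>i. distr M borel (Z i))"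
proof (cases "I = {}")
  \<comment> \<open>This case occurs for \<open>L = 0\<close>: both sides are the probability
    measure on a one-point space.\<close>
  case True
  have "(\<lambda>w. \<lambda>i\<in>{}. Z i w) \<in> M \<rightarrow>\<^sub>M Pi\<^sub>M {} (\<lambda>_. borel)"
    by (intro measurable_restrict) simp
  then show ?thesis
    unfolding joint_law_def True
    by (intro measure_eqI) (auto simp: sets_PiM_empty PiM_empty emeasure_distr subset_singleton_iff
        vimage_def restrict_def emeasure_space_1)
next
  case False
  moreover have "random_variable borel (Z i)" if "i \<in> I" for i
    using assms that by (simp add: indep_vars_def2)
  ultimately show ?thesis
    unfolding joint_law_def using assms
    by (intro indep_vars_iff_distr_eq_PiM'[THEN iffD1]) auto
qed

text \<open>The index formulas are stated for every decomposition, so they do not depend on the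
  chosen representatives. The grouped expansion holds at every point, whereas uniqueness of
  components is almost everywhere. If the conditional variance is zero, both sides of each index
  formula are 0 by \<open>x / 0 = 0\<close>.\<close>

theorem lemma3p2:
  fixes P :: "'w measure"
    and K L p :: nat
    and Theta Xi :: "nat \<Rightarrow> 'w \<Rightarrow> real"
    and fX :: "(nat + nat \<Rightarrow> real) \<Rightarrow> ennreal"
    and \<phi> \<psi> :: "nat \<Rightarrow> nat \<Rightarrow> real poly"
    and y :: "(nat \<Rightarrow> nat) \<Rightarrow> (nat \<Rightarrow> nat) \<Rightarrow> real"
    and \<theta> :: "nat \<Rightarrow> real"
  defines "N \<equiv> joint_law P {1..L} Xi"
    and "A \<equiv> aleatory_set K L p"
    and "AU \<equiv> aleatory_set_on K L p"
    and "c \<equiv> cond_coeff K L p \<phi> y"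
    and "MPC \<equiv> pce K L p \<phi> \<psi> y \<theta>"
    and "M0 \<equiv> (\<integral>x. pce K L p \<phi> \<psi> y \<theta> x \<partial>joint_law P {1..L} Xi)"
    and "MU \<equiv> (\<lambda>u x. \<Sum>b\<in>aleatory_set_on K L p u.
                 cond_coeff K L p \<phi> y b \<theta> * tensor_poly L \<psi> b x)"
  assumes "prob_space P"
    and "prob_space.indep_vars P (\<lambda>_. borel) (case_sum Theta Xi) ({1..K} <+> {1..L})"
    and "distributed P (Pi\<^sub>M ({1..K} <+> {1..L}) (\<lambda>_. lborel))
           (\<lambda>w. \<lambda>i\<in>{1..K} <+> {1..L}. case_sum Theta Xi i w) fX"
    and "\<And>i. i \<in> {1..K} \<Longrightarrow> orthonormal_polys (distr P borel (Theta i)) (\<phi> i)"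
    and "\<And>j. j \<in> {1..L} \<Longrightarrow> orthonormal_polys (distr P borel (Xi j)) (\<psi> j)"
  shows "(\<forall>x. MPC x = (\<Sum>b\<in>A. c b \<theta> * tensor_poly L \<psi> b x)) \<and>
    (\<forall>x. MPC x = M0 + (\<Sum>u\<in>Pow {1..L} - {{}}. MU u x)) \<and>
    sobol_decomposition P {1..L} Xi MPC M0 MU \<and>
    (\<forall>g0 g. sobol_decomposition P {1..L} Xi MPC g0 g \<longrightarrow>
       g0 = M0 \<and>
       (\<forall>u\<in>Pow {1..L} - {{}}. AE x in N. g u x = MU u x) \<and>
       (\<forall>i\<in>{1..L}. sobol_index N MPC g {i} =
          (\<Sum>b\<in>AU {i}. (c b \<theta>)\<^sup>2) / (\<Sum>b\<in>A - {zero_index L}. (c b \<theta>)\<^sup>2)) \<and>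
       (\<forall>u\<in>Pow {1..L} - {{}}. sobol_index N MPC g u =
          (\<Sum>b\<in>AU u. (c b \<theta>)\<^sup>2) / (\<Sum>b\<in>A - {zero_index L}. (c b \<theta>)\<^sup>2)) \<and>
       (\<forall>i\<in>{1..L}. total_sobol_index N {1..L} MPC g i =
          (\<Sum>b\<in>{b\<in>A. b i \<noteq> 0}. (c b \<theta>)\<^sup>2) / (\<Sum>b\<in>A - {zero_index L}. (c b \<theta>)\<^sup>2)))"
proof -
  interpret prob_P: prob_space P by fact
  note One_nat_def [simp del]
  have indep: "prob_P.indep_vars (\<lambda>_. borel) Xi {1..L}"
    using assms(9) by (rule prob_P.indep_vars_case_sum_Inr)
  then have rv: "Xi j \<in> borel_measurable P" if "j \<in> {1..L}" for j
    using that by (simp add: prob_P.indep_vars_def2)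
  \<comment> \<open>Outside \<open>{1..L}\<close> the variable \<open>Xi j\<close> need not be measurable, so \<open>distr\<close> may return junk there.\<close>
  define Q where "Q j = (if j \<in> {1..L} then distr P borel (Xi j) else return borel 0)" for j
  \<comment> \<open>The product locale asks for a probability measure at every natural number, hence
    the Dirac measures outside \<open>{1..L}\<close>.\<close>
  have prob_Q: "prob_space (Q j)" for j
    using rv by (auto simp: Q_def intro!: prob_P.prob_space_distr prob_space_return)
  have "product_prob_space Q" by (intro product_prob_spaceI prob_Q)
  then interpret orthonormal_tensor Q L \<psi>
    using assms(12)
    by (auto simp: orthonormal_tensor_def orthonormal_tensor_axioms_def Q_def
      finite_product_prob_space_def finite_product_sigma_finite_def
      finite_product_sigma_finite_axioms_def product_prob_space_def)
  have Q: "distr P borel (Xi k) = Q k" if "k \<in> {1..L}" for k using that by (simp add: Q_def)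
  have law: "joint_law P {1..L} Xi = Pi\<^sub>M {1..L} Q"
    unfolding prob_P.joint_law_eq_PiM[OF indep] by (intro PiM_cong) (auto simp: Q_def)
  let ?U = "Pow {1..L} - {{}}"
  have A: "finite A" "A \<subseteq> multi_indices L"
    unfolding A_def by (rule finite_aleatory_set) (auto simp: aleatory_set_def)
  have AU: "finite (AU u)" "AU u \<subseteq> multi_indices L" for u
    using A by (auto simp: AU_def A_def aleatory_set_on_def)
  have MPC: "MPC x = (\<Sum>b\<in>A. c b \<theta> * tensor_poly L \<psi> b x)" for x
    by (simp add: MPC_def A_def c_def pce_eq_sum_cond_coeff)
  have MU: "MU u = (\<lambda>x. \<Sum>b\<in>AU u. c b \<theta> * tensor_poly L \<psi> b x)" for u
    by (simp add: MU_def AU_def c_def)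
  have zero: "zero_index L \<in> A" by (simp add: A_def zero_index_in_aleatory_set)
  have mean: "(\<integral>x. MPC x \<partial>Pi\<^sub>M {1..L} Q) = c (zero_index L) \<theta>"
    using zero by (simp add: MPC integral_tensor_sum[OF A])
  then have M0: "M0 = c (zero_index L) \<theta>" by (simp add: M0_def MPC_def law)
  \<comment> \<open>The zero index contributes the mean, and the remaining indices are distributed
    over their supports.\<close>
  have MPC_M0: "MPC x = M0 + (\<Sum>u\<in>?U. MU u x)" for x
    unfolding MPC MU M0 sum_aleatory_set_on[where L = L and K = K and p = p, folded A_def AU_def]
    using A zero by (simp add: sum.remove tensor_poly_zero_index)
  have MU_comp: "sobol_component u (MU u)" if "u \<in> ?U" for u
    unfolding MU using that
    by (intro sobol_component_tensor_sum[OF AU]) (auto simp: AU_def aleatory_set_on_def)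
  \<comment> \<open>\<open>MPC\<close> is measurable and square-integrable as a finite sum, so only
    the representation and the conditions on the components remain.\<close>
  have decomp_iff: "sobol_decomposition P {1..L} Xi MPC g0 g \<longleftrightarrow>
      (AE x in Pi\<^sub>M {1..L} Q. MPC x = g0 + (\<Sum>u\<in>?U. g u x)) \<and>
      (\<forall>u\<in>?U. sobol_component u (g u))" for g0 g
  proof -
    have "MPC \<in> borel_measurable (Pi\<^sub>M {1..L} Q)" "integrable (Pi\<^sub>M {1..L} Q) (\<lambda>x. (MPC x)\<^sup>2)"
      unfolding MPC by (intro borel_measurable_tensor_sum integrable_tensor_sum_square A)+
    moreover have "(\<forall>k\<in>u. AE x in Pi\<^sub>M {1..L} Q. (\<integral>t. g u (x(k := t)) \<partial>distr P borel (Xi k)) = 0) \<longleftrightarrow>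
        (\<forall>k\<in>u. AE x in Pi\<^sub>M {1..L} Q. (\<integral>t. g u (x(k := t)) \<partial>Q k) = 0)" if "u \<in> ?U" for u
      using that Q by (intro ball_cong refl) auto
    ultimately show ?thesis
      unfolding sobol_decomposition_def law sobol_component_def by auto
  qed
  have var_MPC: "prob_space.variance (Pi\<^sub>M {1..L} Q) MPC = (\<Sum>b\<in>A - {zero_index L}. (c b \<theta>)\<^sup>2)"
  proof -
    \<comment> \<open>Centering removes exactly the zero-index term, so Parseval's identity applies
      to the rest.\<close>
    have "MPC x - c (zero_index L) \<theta> = (\<Sum>b\<in>A - {zero_index L}. c b \<theta> * tensor_poly L \<psi> b x)" for x
      unfolding MPC using A zero by (simp add: sum.remove tensor_poly_zero_index)
    then show ?thesis
      unfolding mean using A by (simp add: integral_tensor_sum_square subset_iff)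
  qed
  have unique: "g0 = M0 \<and> (\<forall>u\<in>?U. AE x in Pi\<^sub>M {1..L} Q. g u x = MU u x)"
    if g: "sobol_decomposition P {1..L} Xi MPC g0 g" for g0 g
  proof -
    \<comment> \<open>The differences to the explicit decomposition are components that sum to zero
      with the constant \<open>g0 - M0\<close>.\<close>
    have comp: "sobol_component u (\<lambda>x. g u x - MU u x)" if "u \<in> ?U" for u
      using that g MU_comp by (intro sobol_component_diff) (auto simp: decomp_iff)
    have "AE x in Pi\<^sub>M {1..L} Q. MPC x = g0 + (\<Sum>u\<in>?U. g u x)"
      using g by (simp add: decomp_iff)
    then have AE0: "AE x in Pi\<^sub>M {1..L} Q. g0 - M0 + (\<Sum>u\<in>?U. g u x - MU u x) = 0"
      by eventually_elim (simp add: MPC_M0 sum_subtractf)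
    show ?thesis
      using sobol_components_sum_zero[OF comp AE0] by simp
  qed
  have index: "sobol_index N MPC g u = (\<Sum>b\<in>AU u. (c b \<theta>)\<^sup>2) / (\<Sum>b\<in>A - {zero_index L}. (c b \<theta>)\<^sup>2)"
    if g: "sobol_decomposition P {1..L} Xi MPC g0 g" and u: "u \<in> ?U" for g0 g u
  proof -
    have comp: "sobol_component u (g u)" using g u by (simp add: decomp_iff)
    \<comment> \<open>A component has mean zero, so its variance is its second moment, which depends
      only on its almost-everywhere class and can be computed from \<open>MU u\<close>.\<close>
    have "prob_space.variance (Pi\<^sub>M {1..L} Q) (g u) = (\<integral>x. (g u x)\<^sup>2 \<partial>Pi\<^sub>M {1..L} Q)"
      using integral_sobol_component[OF comp] u by simp
    also have "\<dots> = (\<integral>x. (MU u x)\<^sup>2 \<partial>Pi\<^sub>M {1..L} Q)"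
    proof (rule integral_cong_AE)
      have "AE x in Pi\<^sub>M {1..L} Q. g u x = MU u x" using unique[OF g] u by blast
      then show "AE x in Pi\<^sub>M {1..L} Q. (g u x)\<^sup>2 = (MU u x)\<^sup>2" by eventually_elim simp
    qed (use comp MU_comp[OF u] in \<open>auto simp: sobol_component_def\<close>)
    also have "\<dots> = (\<Sum>b\<in>AU u. (c b \<theta>)\<^sup>2)"
      unfolding MU by (rule integral_tensor_sum_square[OF AU])
    finally show ?thesis by (simp add: sobol_index_def N_def law var_MPC)
  qed
  have total: "total_sobol_index N {1..L} MPC g i =
      (\<Sum>b\<in>{b\<in>A. b i \<noteq> 0}. (c b \<theta>)\<^sup>2) / (\<Sum>b\<in>A - {zero_index L}. (c b \<theta>)\<^sup>2)"
    if g: "sobol_decomposition P {1..L} Xi MPC g0 g" and i: "i \<in> {1..L}" for g0 g i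
  proof -
    \<comment> \<open>Every \<open>u\<close> that contains \<open>i\<close> is non-empty, so
      \<open>index\<close> applies to each summand, with a common denominator.\<close>
    have "total_sobol_index N {1..L} MPC g i =
        (\<Sum>u | u \<subseteq> {1..L} \<and> i \<in> u. (\<Sum>b\<in>AU u. (c b \<theta>)\<^sup>2) / (\<Sum>b\<in>A - {zero_index L}. (c b \<theta>)\<^sup>2))"
      unfolding total_sobol_index_def using index[OF g] by (intro sum.cong refl) auto
    then show ?thesis
      using sum_aleatory_set_on_containing[OF i, where K = K and p = p, folded A_def AU_def]
      by (simp add: sum_divide_distrib[symmetric])
  qed
  have "sobol_decomposition P {1..L} Xi MPC M0 MU"
    using MU_comp by (simp add: decomp_iff MPC_M0)
  moreover have N: "N = Pi\<^sub>M {1..L} Q" by (simp add: N_def law)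
  moreover have "{i} \<in> ?U" if "i \<in> {1..L}" for i using that by simp
  moreover note unique[folded N]
  ultimately show ?thesis
    by (intro conjI allI impI ballI MPC MPC_M0 index total) (assumption | blast)+
qed

end
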